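(* Let $X$ be a topological space, let $I\subset\mathbb{R}$ be an interval, and let $\varphi,\psi,\omega:X\to\mathbb{R}$ and $\alpha,\beta:I\to\mathbb{R}$ be continuous functions. Assume that: $(i_0)$ there exists a (possibly different) topology $\tau_1$ on $X$ such that, for every $\lambda\in I$, the function $\alpha(\lambda)\varphi(\cdot)+\beta(\lambda)\psi(\cdot)+\omega(\cdot)$ is $\tau_1$-lower semicontinuous and, for some $\lambda_0\in I$, the function $\alpha(\lambda_0)\varphi(\cdot)+\beta(\lambda_0)\psi(\cdot)+\omega(\cdot)$ is $\tau_1$-inf-compact; $(i_1)$ there exists a set $D\subseteq I$, dense in $I$, such that, for each $\lambda\in D$, the function $\alpha(\lambda)\varphi(\cdot)+\beta(\lambda)\psi(\cdot)+\omega(\cdot)$ is inf-connected (with respect to the original topology of $X$); $(i_2')$ the functions $\alpha,\beta$ are differentiable in $A$, where $\mathrm{int}(I)\subseteq A\subseteq I$, $\alpha'(\lambda)\ne0$ for all $\lambda\in A$, the function $g:=\frac{\beta'}{\alpha'}$ is strictly monotone in $A$, and $-\frac{\varphi(x)}{\psi(x)}\in g(A)$ for all $x\in X\setminus\psi^{-1}(0)$. Furthermore, assume that one of the following conditions holds: $(i_3')$ $g$ is increasing in $A$ and $\alpha'(\lambda)\psi(x)<0$ for all $(\lambda,x)\in A\times(X\setminus\psi^{-1}(0))$; $(i_4')$ $g$ is decreasing in $A$ and $\alpha'(\lambda)\psi(x)>0$ for all $(\lambda,x)\in A\times(X\setminus\psi^{-1}(0))$. Moreover, assume that $\psi^{-1}(0)=\emptyset$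 and that, for some $x_0\in X$, the function $\alpha(\cdot)\varphi(x_0)+\beta(\cdot)\psi(x_0)$ is sup-compact in $I$. Then there exists $\tilde x\in X$ such that $$\alpha\left(g^{-1}\left(-\frac{\varphi(\tilde x)}{\psi(\tilde x)}\right)\right)\varphi(\tilde x)+\beta\left(g^{-1}\left(-\frac{\varphi(\tilde x)}{\psi(\tilde x)}\right)\right)\psi(\tilde x)+\omega(\tilde x)$$ $$=\inf_{x\in X}\left(\alpha\left(g^{-1}\left(-\frac{\varphi(\tilde x)}{\psi(\tilde x)}\right)\right)\varphi(x)+\beta\left(g^{-1}\left(-\frac{\varphi(\tilde x)}{\psi(\tilde x)}\right)\right)\psi(x)+\omega(x)\right).$$
   Context: A function $\eta:Y\to\mathbb{R}$ on a topological space $Y$ is called inf-connected if, for each $r\in\mathbb{R}$, the set $\eta^{-1}(]-\infty,r[)$ is connected (the empty set is regarded as connected), and inf-compact if, for each $r\in\mathbb{R}$, the set $\eta^{-1}(]-\infty,r])$ is compact; $\eta$ is sup-compact if $-\eta$ is inf-compact. The prefix $\tau_1$- means that the property refers to the topology $\tau_1$. Derivatives at an endpoint of $I$ belonging to $A$ are one-sided. $g^{-1}:g(A)\to A$ is the inverse of the injective function $g:A\to\mathbb{R}$. *)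

theory Defs
  imports "HOL-Analysis.Analysis"
begin

definition inf_connected :: "'a topology \<Rightarrow> ('a \<Rightarrow> real) \<Rightarrow> bool" where
  "inf_connected Y f \<longleftrightarrow> (\<forall>r. connectedin Y {y \<in> topspace Y. f y < r})"

definition inf_compact :: "'a topology \<Rightarrow> ('a \<Rightarrow> real) \<Rightarrow> bool" where
  "inf_compact Y f \<longleftrightarrow> (\<forall>r. compactin Y {y \<in> topspace Y. f y \<le> r})"

definition sup_compact :: "'a topology \<Rightarrow> ('a \<Rightarrow> real) \<Rightarrow> bool" where
  "sup_compact Y f \<longleftrightarrow> inf_compact Y (\<lambda>y. - f y)"

definition lower_semicontinuous :: "'a topology \<Rightarrow> ('a \<Rightarrow> real) \<Rightarrow> bool" where
  "lower_semicontinuous Y f \<longleftrightarrow> (\<forall>r. openin Y {y \<in> topspace Y. r < f y})"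

end

theory Submission
  imports Defs
begin

text \<open>
  Write \<open>f x \<mu> = \<alpha> \<mu> * \<phi> x + \<beta> \<mu> * \<psi> x + \<omega> x\<close>. The sign conditions make \<open>f x\<close> increase strictly up to
  \<open>p x = g\<^sup>-\<^sup>1 (- \<phi> x / \<psi> x)\<close> and decrease strictly afterwards, so \<open>p x\<close> is its unique maximiser.
  The envelope \<open>x \<mapsto> f x (p x)\<close> is lower semicontinuous and inf-compact for the second topology;
  let \<open>y\<close> minimise it, with minimum \<open>M\<close>. If some \<open>\<nu>\<close> in the interval satisfies \<open>M \<le> f x \<nu>\<close> for all \<open>x\<close>,
  then \<open>\<nu>\<close> maximises \<open>f y\<close>, so \<open>\<nu> = p y\<close>, which is the claim. Otherwise every \<open>{x. f x \<nu> < M}\<close>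
  is non-empty and split by the disjoint open sets \<open>{x. \<nu> < p x}\<close> and \<open>{x. p x < \<nu>}\<close>. The parameters
  for which the first, respectively the second, part is non-empty form two relatively open sets
  covering the interval. Both are non-empty by sup-compactness, so they overlap, and density yields
  an inf-connected \<open>f \<sqdot> \<nu>\<close> with a disconnected sublevel set.
\<close>

section \<open>Minimising over the space\<close>

text \<open>Without a minimiser the open sets \<open>U z\<close> cover a compact sublevel set; in a
  finite subcover the index with least value is left uncovered.\<close>

lemma lower_semicontinuous_inf_compact_attains_min:
  assumes lsc: "lower_semicontinuous Y h" and cpt: "inf_compact Y h" and x0: "x0 \<in> topspace Y"
  shows "\<exists>y\<in>topspace Y. \<forall>x\<in>topspace Y. h y \<le> h x"
proof (rule ccontr)
  assume "\<not> ?thesis"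
  then have ex: "\<forall>y\<in>topspace Y. \<exists>x\<in>topspace Y. h x < h y"
    by (meson not_le)
  define K where "K = {y \<in> topspace Y. h y \<le> h x0}"
  define U where "U z = {y \<in> topspace Y. h z < h y}" for z
  have "compactin Y K"
    using cpt by (simp add: inf_compact_def K_def)
  moreover have "openin Y V" if "V \<in> U ` topspace Y" for V
    using lsc that by (auto simp: lower_semicontinuous_def U_def)
  moreover have "K \<subseteq> \<Union>(U ` topspace Y)"
    using ex by (auto simp: K_def U_def)
  ultimately obtain F where F: "finite F" "F \<subseteq> U ` topspace Y" "K \<subseteq> \<Union>F"
    by (meson compactinD)
  then obtain Z where Z: "finite Z" "Z \<subseteq> topspace Y" "F = U ` Z"
    by (meson finite_subset_image)
  have "x0 \<in> K"
    using x0 by (simp add: K_def)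
  \<comment> \<open>Covering \<open>x0\<close> puts a value of \<open>h\<close> on \<open>Z\<close>
    below \<open>h x0\<close>; this makes the least-valued \<open>z\<close> a point of
    \<open>K\<close>.\<close>
  then obtain z0 where z0: "z0 \<in> Z" "h z0 < h x0"
    using F Z by (auto simp: U_def)
  obtain z where z: "z \<in> Z" "\<forall>w\<in>Z. h z \<le> h w"
    using arg_min_if_finite(1)[of Z h] arg_min_least[of Z _ h] Z(1) z0(1)
    by (metis empty_iff)
  have "z \<in> K"
    using z z0 Z by (force simp: K_def)
  then obtain w where "w \<in> Z" "h w < h z"
    using F Z by (auto simp: U_def)
  then show False
    using z by force
qed

text \<open>\<open>f x (p x)\<close> is the supremum of \<open>f x\<close> over \<open>I\<close>, so
  its strict superlevel sets are unions of open ones and its sublevel sets are closed subsets of the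
  compact sublevel sets at \<open>\<mu>0\<close>.\<close>

lemma sup_of_lower_semicontinuous_attains_min:
  fixes f :: "'a \<Rightarrow> 'b \<Rightarrow> real"
  assumes lsc: "\<And>\<mu>. \<mu> \<in> I \<Longrightarrow> lower_semicontinuous Y (\<lambda>x. f x \<mu>)"
    and cpt: "\<mu>0 \<in> I" "inf_compact Y (\<lambda>x. f x \<mu>0)"
    and p: "\<And>x. x \<in> topspace Y \<Longrightarrow> p x \<in> I"
    and max: "\<And>x \<mu>. x \<in> topspace Y \<Longrightarrow> \<mu> \<in> I \<Longrightarrow> f x \<mu> \<le> f x (p x)"
    and x0: "x0 \<in> topspace Y"
  shows "\<exists>y\<in>topspace Y. \<forall>x\<in>topspace Y. f y (p y) \<le> f x (p x)"
proof (rule lower_semicontinuous_inf_compact_attains_min[OF _ _ x0, where h = "\<lambda>x. f x (p x)"])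
  have op: "openin Y {x \<in> topspace Y. r < f x (p x)}" for r
  proof -
    have "{x \<in> topspace Y. r < f x (p x)} = (\<Union>\<mu>\<in>I. {x \<in> topspace Y. r < f x \<mu>})"
      using p max by (fastforce intro: less_le_trans)
    then show ?thesis
      using lsc by (auto simp: lower_semicontinuous_def)
  qed
  then show "lower_semicontinuous Y (\<lambda>x. f x (p x))"
    by (simp add: lower_semicontinuous_def)
  show "inf_compact Y (\<lambda>x. f x (p x))"
    unfolding inf_compact_def
  proof
    fix r
    have "{x \<in> topspace Y. f x (p x) \<le> r} = topspace Y - {x \<in> topspace Y. r < f x (p x)}"
      by auto
    then have "closedin Y {x \<in> topspace Y. f x (p x) \<le> r}"
      using op by auto
    moreover have "compactin Y {x \<in> topspace Y. f x \<mu>0 \<le> r}"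
      using cpt by (simp add: inf_compact_def)
    moreover have "{x \<in> topspace Y. f x (p x) \<le> r} \<subseteq> {x \<in> topspace Y. f x \<mu>0 \<le> r}"
      using max cpt(1) by (auto intro: order_trans)
    ultimately show "compactin Y {x \<in> topspace Y. f x (p x) \<le> r}"
      using closed_compactin by blast
  qed
qed

section \<open>Connectedness and a common parameter\<close>

text \<open>When \<open>M\<close> is the minimum over \<open>x\<close> of the maxima
  \<open>f x (p x)\<close>, this is the minimax equality, attained at \<open>\<mu>\<close>. A strict
  sublevel set for \<open>M\<close> contains no \<open>x\<close> with \<open>p x = \<mu>\<close>,
  which is what separates it.\<close>

lemma inf_connected_maximin:
  fixes f :: "'a \<Rightarrow> real \<Rightarrow> real"
  assumes I: "connected I"
    and cont: "\<And>x. x \<in> topspace X \<Longrightarrow> continuous_on I (f x)"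
    and D: "D \<subseteq> I" "I \<subseteq> closure D"
    and conn: "\<And>\<mu>. \<mu> \<in> D \<Longrightarrow> inf_connected X (\<lambda>x. f x \<mu>)"
    and p: "\<And>x. x \<in> topspace X \<Longrightarrow> p x \<in> I"
    and rays: "\<And>\<mu>. \<mu> \<in> D \<Longrightarrow> openin X {x \<in> topspace X. p x < \<mu>}"
      "\<And>\<mu>. \<mu> \<in> D \<Longrightarrow> openin X {x \<in> topspace X. \<mu> < p x}"
    and M: "\<And>x. x \<in> topspace X \<Longrightarrow> M \<le> f x (p x)"
    and x0: "x0 \<in> topspace X"
    and cpt: "compact {\<mu> \<in> I. M \<le> f x0 \<mu>}"
  shows "\<exists>\<mu>\<in>I. \<forall>x\<in>topspace X. M \<le> f x \<mu>"
proof (rule ccontr)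
  assume "\<not> ?thesis"
  then have ex: "\<exists>x\<in>topspace X. f x \<mu> < M" if "\<mu> \<in> I" for \<mu>
    using that by (meson not_le)
  define P where "P = {\<mu> \<in> I. \<exists>x\<in>topspace X. f x \<mu> < M \<and> \<mu> < p x}"
  define Q where "Q = {\<mu> \<in> I. \<exists>x\<in>topspace X. f x \<mu> < M \<and> p x < \<mu>}"
  have sub: "openin (top_of_set I) (I \<inter> f x -` {..<M} \<inter> T)" if "x \<in> topspace X" "open T" for x T
    using continuous_openin_preimage_gen[OF cont[OF that(1)], of "{..<M}"] that(2)
    by (simp add: openin_Int_open)
  \<comment> \<open>For fixed \<open>x\<close> both conditions are relatively open in the
    parameter.\<close>
  have "P = (\<Union>x\<in>topspace X. I \<inter> f x -` {..<M} \<inter> {..<p x})"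
    by (auto simp: P_def)
  then have P: "openin (top_of_set I) P"
    using sub by auto
  have "Q = (\<Union>x\<in>topspace X. I \<inter> f x -` {..<M} \<inter> {p x<..})"
    by (auto simp: Q_def)
  then have Q: "openin (top_of_set I) Q"
    using sub by auto
  have neq: "p x \<noteq> \<mu>" if "x \<in> topspace X" "f x \<mu> < M" for x \<mu>
    using M[OF that(1)] that(2) by auto
  have cover: "I \<subseteq> P \<union> Q"
    using ex neq by (fastforce simp: P_def Q_def)
  have K: "{\<mu> \<in> I. M \<le> f x0 \<mu>} \<noteq> {}"
    using M p x0 by blast
  have "P \<noteq> {}"
  proof -
    \<comment> \<open>\<open>m\<close> is the least parameter at which \<open>f x0\<close> reaches
      \<open>M\<close>. A point \<open>x\<close> with \<open>f x m < M\<close> and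
      \<open>m < p x\<close> shows \<open>m \<in> P\<close>. Otherwise
      \<open>p x < m \<le> p x0\<close>, so \<open>f x0\<close> is below \<open>M\<close> at
      \<open>p x\<close>, and \<open>x0\<close> shows \<open>p x \<in> P\<close>.\<close>
    obtain m where m: "m \<in> I" "\<And>\<mu>. \<mu> \<in> I \<Longrightarrow> M \<le> f x0 \<mu> \<Longrightarrow> m \<le> \<mu>"
      using compact_attains_inf[OF cpt K] by auto
    obtain x where x: "x \<in> topspace X" "f x m < M"
      using ex m by blast
    show ?thesis
    proof (cases "m < p x")
      case True
      then show ?thesis using m x by (auto simp: P_def)
    next
      case False
      then have "p x < m"
        using neq[OF x] by simp
      moreover have "m \<le> p x0"
        using m p M x0 by blast
      ultimately have "f x0 (p x) < M" "p x < p x0"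
        using m(2)[OF p[OF x(1)]] by linarith+
      then show ?thesis
        using p x x0 by (auto simp: P_def)
    qed
  qed
  moreover have "Q \<noteq> {}"
  proof -
    \<comment> \<open>Mirror image, with the greatest such parameter.\<close>
    obtain m where m: "m \<in> I" "\<And>\<mu>. \<mu> \<in> I \<Longrightarrow> M \<le> f x0 \<mu> \<Longrightarrow> \<mu> \<le> m"
      using compact_attains_sup[OF cpt K] by auto
    obtain x where x: "x \<in> topspace X" "f x m < M"
      using ex m by blast
    show ?thesis
    proof (cases "p x < m")
      case True
      then show ?thesis using m x by (auto simp: Q_def)
    next
      case False
      then have "m < p x"
        using neq[OF x] by simp
      moreover have "p x0 \<le> m"
        using m p M x0 by blast
      ultimately have "f x0 (p x) < M" "p x0 < p x"
        using m(2)[OF p[OF x(1)]] by linarith+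
      then show ?thesis
        using p x x0 by (auto simp: Q_def)
    qed
  qed
  ultimately have "P \<inter> Q \<noteq> {}"
    using I P Q cover unfolding connected_openin by blast
  then obtain \<mu> where \<mu>: "\<mu> \<in> P \<inter> Q"
    by blast
  \<comment> \<open>Connected sublevel sets are available only at parameters in \<open>D\<close>;
    since the overlap is relatively open, it contains one.\<close>
  obtain U where U: "open U" "P \<inter> Q = I \<inter> U"
    using openin_Int[OF P Q] by (auto simp: openin_open)
  have "\<mu> \<in> closure D" "\<mu> \<in> U"
    using \<mu> U(2) D by blast+
  then obtain d where d: "d \<in> D" "d \<in> P \<inter> Q"
    using U D(1) by (metis IntI closure_iff_nhds_not_empty disjoint_iff order_refl subsetD)
  define S where "S = {x \<in> topspace X. f x d < M}"
  have "S \<subseteq> {x \<in> topspace X. p x < d} \<union> {x \<in> topspace X. d < p x}"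
    using neq by (force simp: S_def)
  moreover have "{x \<in> topspace X. p x < d} \<inter> {x \<in> topspace X. d < p x} \<inter> S = {}"
    by auto
  moreover have "{x \<in> topspace X. p x < d} \<inter> S \<noteq> {}" "{x \<in> topspace X. d < p x} \<inter> S \<noteq> {}"
    using d(2) by (auto simp: P_def Q_def S_def)
  ultimately have "\<not> connectedin X S"
    using rays[OF d(1)] unfolding connectedin by blast
  then show False
    using conn[OF d(1)] by (simp add: inf_connected_def S_def)
qed

section \<open>Maximising over the parameter\<close>

text \<open>The open segment between two points of \<open>I\<close> lies in the interior, where the
  sign of the derivative is known; continuity extends strict monotonicity to the closed segment,
  including endpoints of \<open>I\<close> outside \<open>A\<close>.\<close>

lemma unique_maximum_by_derivative_sign:
  fixes f f' :: "real \<Rightarrow> real"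
  assumes I: "is_interval I" and cont: "continuous_on I f" and A: "interior I \<subseteq> A"
    and deriv: "\<And>\<mu>. \<mu> \<in> A \<Longrightarrow> (f has_real_derivative f' \<mu>) (at \<mu> within I)"
    and pos: "\<And>\<mu>. \<mu> \<in> A \<Longrightarrow> \<mu> < m \<Longrightarrow> 0 < f' \<mu>"
    and neg: "\<And>\<mu>. \<mu> \<in> A \<Longrightarrow> m < \<mu> \<Longrightarrow> f' \<mu> < 0"
    and m: "m \<in> I" and \<mu>: "\<mu> \<in> I" "\<mu> \<noteq> m"
  shows "f \<mu> < f m"
proof -
  have sub: "{a..b} \<subseteq> I" "{a<..<b} \<subseteq> interior I" if "a \<in> I" "b \<in> I" for a b
  proof -
    show ab: "{a..b} \<subseteq> I"
      using mem_is_interval_1_I[OF I that] by auto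
    then show "{a<..<b} \<subseteq> interior I"
      by (intro interior_maximal) auto
  qed
  have d: "(f has_real_derivative f' \<nu>) (at \<nu>)" "\<nu> \<in> A"
    if "a \<in> I" "b \<in> I" "a < \<nu>" "\<nu> < b" for a b \<nu>
  proof -
    have "\<nu> \<in> interior I"
      using sub(2)[OF that(1,2)] that by auto
    then show "\<nu> \<in> A" "(f has_real_derivative f' \<nu>) (at \<nu>)"
      using A deriv[of \<nu>] at_within_interior[of \<nu> I] by auto
  qed
  consider "\<mu> < m" | "m < \<mu>"
    using \<mu> by linarith
  then show ?thesis
  proof cases
    case 1
    show ?thesis
    proof (rule DERIV_pos_imp_increasing_open[OF 1])
      show "continuous_on {\<mu>..m} f"
        using cont sub(1) m \<mu> continuous_on_subset by blast
      show "\<exists>y. DERIV f x :> y \<and> 0 < y" if "\<mu> < x" "x < m" for x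
        using d[OF \<mu>(1) m that] pos that by blast
    qed
  next
    case 2
    show ?thesis
    proof (rule DERIV_neg_imp_decreasing_open[OF 2])
      show "continuous_on {m..\<mu>} f"
        using cont sub(1) m \<mu> continuous_on_subset by blast
      show "\<exists>y. DERIV f x :> y \<and> y < 0" if "m < x" "x < \<mu>" for x
        using d[OF m \<mu>(1) that] neg that by blast
    qed
  qed
qed

lemma interval_endpoint:
  fixes \<mu> :: real
  assumes "is_interval I" "\<mu> \<in> I" "\<mu> \<notin> interior I"
  shows "(\<forall>\<nu>\<in>I. \<nu> \<le> \<mu>) \<or> (\<forall>\<nu>\<in>I. \<mu> \<le> \<nu>)"
proof (rule ccontr)
  assume "\<not> ?thesis"
  then obtain a b where ab: "a \<in> I" "b \<in> I" "a < \<mu>" "\<mu> < b"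
    by (meson not_le)
  then have "{a<..<b} \<subseteq> I"
    using mem_is_interval_1_I[OF assms(1) ab(1,2)] by auto
  then have "{a<..<b} \<subseteq> interior I"
    by (simp add: interior_maximal)
  then show False
    using ab assms(3) by auto
qed

text \<open>On \<open>A\<close> the order is tested through \<open>g\<close>: comparing
  \<open>p x\<close> with \<open>\<mu>\<close> amounts to comparing \<open>g (p x)\<close> with
  \<open>g \<mu>\<close>, an open condition by continuity of the composite.\<close>

lemma openin_rays_if_monotone_continuous:
  fixes p :: "'a \<Rightarrow> real" and g :: "real \<Rightarrow> real"
  assumes I: "is_interval I" and A: "interior I \<subseteq> A" "A \<subseteq> I"
    and g: "strict_mono_on A g \<or> strict_antimono_on A g"
    and p: "\<And>x. x \<in> topspace X \<Longrightarrow> p x \<in> A"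
    and gp: "continuous_map X euclideanreal (\<lambda>x. g (p x))"
    and \<mu>: "\<mu> \<in> I"
  shows "openin X {x \<in> topspace X. p x < \<mu>}" and "openin X {x \<in> topspace X. \<mu> < p x}"
proof -
  have *: "openin X {x \<in> topspace X. p x < \<mu>} \<and> openin X {x \<in> topspace X. \<mu> < p x}"
  proof (cases "\<mu> \<in> A")
    case True
    have op: "openin X {x \<in> topspace X. g (p x) < g \<mu>}" "openin X {x \<in> topspace X. g \<mu> < g (p x)}"
      using openin_continuous_map_preimage[OF gp, of "{..<g \<mu>}"]
        openin_continuous_map_preimage[OF gp, of "{g \<mu><..}"] by auto
    show ?thesis
      using g
    proof
      assume g: "strict_mono_on A g"
      have "{x \<in> topspace X. p x < \<mu>} = {x \<in> topspace X. g (p x) < g \<mu>}"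
        "{x \<in> topspace X. \<mu> < p x} = {x \<in> topspace X. g \<mu> < g (p x)}"
        using strict_mono_on_less[OF g] p True by auto
      then show ?thesis
        using op by simp
    next
      assume "strict_antimono_on A g"
      then have g: "strict_mono_on A (\<lambda>\<nu>. - g \<nu>)"
        by (simp add: monotone_on_def)
      have "{x \<in> topspace X. p x < \<mu>} = {x \<in> topspace X. g \<mu> < g (p x)}"
        "{x \<in> topspace X. \<mu> < p x} = {x \<in> topspace X. g (p x) < g \<mu>}"
        using strict_mono_on_less[OF g] p True by auto
      then show ?thesis
        using op by simp
    qed
  next
    case False
    \<comment> \<open>Outside \<open>A\<close>, \<open>\<mu>\<close> is an endpoint of
      \<open>I\<close> and not a value of \<open>p\<close>, so one ray is the whole space and the
      other is empty.\<close>
    then consider "\<forall>\<nu>\<in>I. \<nu> \<le> \<mu>" | "\<forall>\<nu>\<in>I. \<mu> \<le> \<nu>"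
      using interval_endpoint[OF I \<mu>] A by blast
    then show ?thesis
    proof cases
      case 1
      then have "{x \<in> topspace X. p x < \<mu>} = topspace X" "{x \<in> topspace X. \<mu> < p x} = {}"
        using p A False by (force simp: less_le)+
      then show ?thesis by (metis openin_empty openin_topspace)
    next
      case 2
      then have "{x \<in> topspace X. \<mu> < p x} = topspace X" "{x \<in> topspace X. p x < \<mu>} = {}"
        using p A False by (force simp: less_le)+
      then show ?thesis by (metis openin_empty openin_topspace)
    qed
  qed
  show "openin X {x \<in> topspace X. p x < \<mu>}" "openin X {x \<in> topspace X. \<mu> < p x}"
    using * by auto
qed

section \<open>Minimax for the given family\<close>

theorem theorem1p3:
  fixes X :: "'a topology"
    and \<phi> \<psi> \<omega> :: "'a \<Rightarrow> real"
    and I A :: "real set"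
    and \<alpha> \<beta> \<alpha>' \<beta>' g :: "real \<Rightarrow> real"
    and x\<^sub>0 :: 'a
  assumes "is_interval I"
    and "continuous_map X euclideanreal \<phi>"
    and "continuous_map X euclideanreal \<psi>"
    and "continuous_map X euclideanreal \<omega>"
    and "continuous_on I \<alpha>"
    and "continuous_on I \<beta>"
    and i0: "\<exists>\<tau>\<^sub>1 :: 'a topology. topspace \<tau>\<^sub>1 = topspace X \<and>
          (\<forall>\<mu>\<in>I. lower_semicontinuous \<tau>\<^sub>1 (\<lambda>x. \<alpha> \<mu> * \<phi> x + \<beta> \<mu> * \<psi> x + \<omega> x)) \<and>
          (\<exists>\<mu>\<^sub>0\<in>I. inf_compact \<tau>\<^sub>1 (\<lambda>x. \<alpha> \<mu>\<^sub>0 * \<phi> x + \<beta> \<mu>\<^sub>0 * \<psi> x + \<omega> x))"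
    and i1: "\<exists>D\<subseteq>I. I \<subseteq> closure D \<and>
          (\<forall>\<mu>\<in>D. inf_connected X (\<lambda>x. \<alpha> \<mu> * \<phi> x + \<beta> \<mu> * \<psi> x + \<omega> x))"
    and i2_A: "interior I \<subseteq> A" "A \<subseteq> I"
    and i2_\<alpha>: "\<forall>\<mu>\<in>A. (\<alpha> has_real_derivative \<alpha>' \<mu>) (at \<mu> within I)"
    and i2_\<beta>: "\<forall>\<mu>\<in>A. (\<beta> has_real_derivative \<beta>' \<mu>) (at \<mu> within I)"
    and i2_nz: "\<forall>\<mu>\<in>A. \<alpha>' \<mu> \<noteq> 0"
    and i2_g: "\<forall>\<mu>\<in>A. g \<mu> = \<beta>' \<mu> / \<alpha>' \<mu>"
    and i2_mono: "strict_mono_on A g \<or> strict_antimono_on A g"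
    and i2_range: "\<forall>x \<in> topspace X - {x \<in> topspace X. \<psi> x = 0}. - (\<phi> x / \<psi> x) \<in> g ` A"
    and i3_i4:
      "(mono_on A g \<and>
          (\<forall>\<mu>\<in>A. \<forall>x \<in> topspace X - {x \<in> topspace X. \<psi> x = 0}. \<alpha>' \<mu> * \<psi> x < 0)) \<or>
       (antimono_on A g \<and>
          (\<forall>\<mu>\<in>A. \<forall>x \<in> topspace X - {x \<in> topspace X. \<psi> x = 0}. \<alpha>' \<mu> * \<psi> x > 0))"
    and "{x \<in> topspace X. \<psi> x = 0} = {}"
    and "x\<^sub>0 \<in> topspace X"
    and "sup_compact (top_of_set I) (\<lambda>\<mu>. \<alpha> \<mu> * \<phi> x\<^sub>0 + \<beta> \<mu> * \<psi> x\<^sub>0)"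
  shows "\<exists>y \<in> topspace X.
      let \<mu> = the_inv_into A g (- (\<phi> y / \<psi> y))
      in ereal (\<alpha> \<mu> * \<phi> y + \<beta> \<mu> * \<psi> y + \<omega> y) =
         (INF x \<in> topspace X. ereal (\<alpha> \<mu> * \<phi> x + \<beta> \<mu> * \<psi> x + \<omega> x))"
proof -
  define f where "f x \<mu> = \<alpha> \<mu> * \<phi> x + \<beta> \<mu> * \<psi> x + \<omega> x" for x \<mu>
  define p where "p x = the_inv_into A g (- (\<phi> x / \<psi> x))" for x
  have \<psi>: "\<psi> x \<noteq> 0" if "x \<in> topspace X" for x
    using assms(18) that by auto
  have inj: "inj_on g A"
    using i2_mono by (auto simp: monotone_on_def inj_on_def neq_iff) (metis less_irrefl neq_iff)+
  have pA: "p x \<in> A" and gp: "g (p x) = - (\<phi> x / \<psi> x)" if "x \<in> topspace X" for x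
    using i2_range \<psi>[OF that] that the_inv_into_into[OF inj, of _ A] f_the_inv_into_f[OF inj]
    by (auto simp: p_def)
  have pI: "p x \<in> I" if "x \<in> topspace X" for x
    using pA i2_A that by blast
  have cont: "continuous_on I (f x)" for x
    unfolding f_def by (intro continuous_intros assms)
  have deriv: "(f x has_real_derivative \<alpha>' \<mu> * \<phi> x + \<beta>' \<mu> * \<psi> x) (at \<mu> within I)"
    if "\<mu> \<in> A" for x \<mu>
    unfolding f_def using i2_\<alpha> i2_\<beta> that by (auto intro!: derivative_eq_intros)
  \<comment> \<open>Factor out \<open>\<alpha>' \<mu> * \<psi> x\<close>; what remains is
    \<open>g \<mu> + \<phi> x / \<psi> x\<close>, and \<open>g (p x)\<close> is minus the
    quotient.\<close>
  have deriv_eq: "\<alpha>' \<mu> * \<phi> x + \<beta>' \<mu> * \<psi> x = (\<alpha>' \<mu> * \<psi> x) * (g \<mu> - g (p x))"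
    if "\<mu> \<in> A" "x \<in> topspace X" for x \<mu>
    using gp[OF that(2)] i2_g i2_nz \<psi>[OF that(2)] that(1) by (simp add: field_simps)
  \<comment> \<open>In both cases the first factor has the sign opposite to the direction of
    \<open>g\<close>, so the product passes from positive to negative at \<open>p x\<close>;
    injectivity of \<open>g\<close> makes this strict.\<close>
  have sign: "0 < (\<alpha>' \<mu> * \<psi> x) * (g \<mu> - g (p x)) \<longleftrightarrow> \<mu> < p x"
    "(\<alpha>' \<mu> * \<psi> x) * (g \<mu> - g (p x)) < 0 \<longleftrightarrow> p x < \<mu>"
    if "\<mu> \<in> A" "x \<in> topspace X" for x \<mu>
  proof -
    note px = pA[OF that(2)]
    have ne: "g \<mu> = g (p x) \<longleftrightarrow> \<mu> = p x"
      using inj px that(1) by (simp add: inj_on_eq_iff)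
    from i3_i4 have "(0 < (\<alpha>' \<mu> * \<psi> x) * (g \<mu> - g (p x)) \<longleftrightarrow> \<mu> < p x)
      \<and> ((\<alpha>' \<mu> * \<psi> x) * (g \<mu> - g (p x)) < 0 \<longleftrightarrow> p x < \<mu>)"
    proof (elim disjE conjE)
      assume g: "mono_on A g" and "\<forall>\<mu>\<in>A. \<forall>x \<in> topspace X - {x \<in> topspace X. \<psi> x = 0}. \<alpha>' \<mu> * \<psi> x < 0"
      then have "\<alpha>' \<mu> * \<psi> x < 0"
        using that \<psi> by auto
      moreover have "\<mu> \<le> p x \<Longrightarrow> g \<mu> \<le> g (p x)" "p x \<le> \<mu> \<Longrightarrow> g (p x) \<le> g \<mu>"
        using g that px by (auto simp: monotone_on_def)
      ultimately show ?thesis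
        using ne unfolding zero_less_mult_iff mult_less_0_iff by linarith
    next
      assume g: "antimono_on A g" and "\<forall>\<mu>\<in>A. \<forall>x \<in> topspace X - {x \<in> topspace X. \<psi> x = 0}. 0 < \<alpha>' \<mu> * \<psi> x"
      then have "0 < \<alpha>' \<mu> * \<psi> x"
        using that \<psi> by auto
      moreover have "\<mu> \<le> p x \<Longrightarrow> g (p x) \<le> g \<mu>" "p x \<le> \<mu> \<Longrightarrow> g \<mu> \<le> g (p x)"
        using g that px by (auto simp: monotone_on_def)
      ultimately show ?thesis
        using ne unfolding zero_less_mult_iff mult_less_0_iff by linarith
    qed
    then show "0 < (\<alpha>' \<mu> * \<psi> x) * (g \<mu> - g (p x)) \<longleftrightarrow> \<mu> < p x"
      "(\<alpha>' \<mu> * \<psi> x) * (g \<mu> - g (p x)) < 0 \<longleftrightarrow> p x < \<mu>" by auto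
  qed
  have max: "f x \<mu> < f x (p x)" if "x \<in> topspace X" "\<mu> \<in> I" "\<mu> \<noteq> p x" for x \<mu>
    by (rule unique_maximum_by_derivative_sign[OF \<open>is_interval I\<close> cont i2_A(1) deriv _ _ pI that(2,3)])
      (use that sign deriv_eq in auto)
  have max_le: "f x \<mu> \<le> f x (p x)" if "x \<in> topspace X" "\<mu> \<in> I" for x \<mu>
    using max[OF that] by (cases "\<mu> = p x") auto
  have "continuous_map X euclideanreal (\<lambda>x. - (\<phi> x / \<psi> x))"
    using assms(2,3) \<psi> by (intro continuous_intros) auto
  then have gp_cont: "continuous_map X euclideanreal (\<lambda>x. g (p x))"
    by (rule continuous_map_eq) (simp add: gp)
  have "\<exists>y\<in>topspace X. \<forall>x\<in>topspace X. f y (p y) \<le> f x (p x)"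
  proof -
    obtain \<tau> :: "'a topology" and \<mu>0 where \<tau>: "topspace \<tau> = topspace X"
      "\<And>\<mu>. \<mu> \<in> I \<Longrightarrow> lower_semicontinuous \<tau> (\<lambda>x. f x \<mu>)"
      "\<mu>0 \<in> I" "inf_compact \<tau> (\<lambda>x. f x \<mu>0)"
      using i0 unfolding f_def by blast
    show ?thesis
      using sup_of_lower_semicontinuous_attains_min[of I \<tau> f \<mu>0 p x\<^sub>0] \<tau> pI max_le assms(19) by simp
  qed
  then obtain y where y: "y \<in> topspace X" "\<And>x. x \<in> topspace X \<Longrightarrow> f y (p y) \<le> f x (p x)"
    by blast
  obtain D where D: "D \<subseteq> I" "I \<subseteq> closure D" "\<And>\<mu>. \<mu> \<in> D \<Longrightarrow> inf_connected X (\<lambda>x. f x \<mu>)"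
    using i1 unfolding f_def by blast
  have "compact {\<mu> \<in> I. f y (p y) \<le> f x\<^sub>0 \<mu>}"
  proof -
    \<comment> \<open>The sup-compact function lacks the term \<open>\<omega> x\<^sub>0\<close>,
      constant in the parameter; it is absorbed into the level.\<close>
    have "compactin (top_of_set I)
        {\<mu> \<in> I. - (\<alpha> \<mu> * \<phi> x\<^sub>0 + \<beta> \<mu> * \<psi> x\<^sub>0) \<le> \<omega> x\<^sub>0 - f y (p y)}"
      using assms(20) by (simp add: sup_compact_def inf_compact_def)
    moreover have "{\<mu> \<in> I. - (\<alpha> \<mu> * \<phi> x\<^sub>0 + \<beta> \<mu> * \<psi> x\<^sub>0) \<le> \<omega> x\<^sub>0 - f y (p y)}
        = {\<mu> \<in> I. f y (p y) \<le> f x\<^sub>0 \<mu>}"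
      unfolding f_def by (auto simp: algebra_simps)
    ultimately show ?thesis
      by (simp add: compactin_subtopology)
  qed
  then have "\<exists>\<mu>\<in>I. \<forall>x\<in>topspace X. f y (p y) \<le> f x \<mu>"
    using inf_connected_maximin[of I X f D p "f y (p y)" x\<^sub>0] is_interval_connected[OF assms(1)]
      cont D pI y assms(19)
      openin_rays_if_monotone_continuous[OF assms(1) i2_A i2_mono pA gp_cont]
    by (simp add: subset_iff)
  then obtain \<mu> where \<mu>: "\<mu> \<in> I" "\<And>x. x \<in> topspace X \<Longrightarrow> f y (p y) \<le> f x \<mu>"
    by blast
  \<comment> \<open>Any parameter other than \<open>p y\<close> would give \<open>f y\<close> a
    value strictly below the minimum.\<close>
  have "\<mu> = p y"
    using max[OF y(1) \<mu>(1)] \<mu>(2)[OF y(1)] by force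
  then have "ereal (f y (p y)) = (INF x\<in>topspace X. ereal (f x (p y)))"
    using \<mu>(2) y(1) by (intro antisym INF_greatest INF_lower) auto
  then show ?thesis
    using y(1) unfolding f_def p_def Let_def by blast
qed

end
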